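(* Let $G=(V,E)$ be a finite directed graph, $K$ a kernel on $G$ with nowhere-zero stationary distribution $\pi$, and $\phi(u,v)=K(u,v)\pi(u)$. For every $1\le n\le |V|$, $$\iota_n(G,K)=\gamma_n(G,K),$$ where $$\iota_n(G,K)=\min_{\{Q_1,\dots,Q_n\}}\ \frac1n\sum_{i=1}^n\frac{\vec\partial(Q_i)}{\pi(Q_i)}$$ (minimum over all families of $n$ nonempty pairwise disjoint subsets of $V$, not necessarily covering $V$) and $$\gamma_n(G,K)=\min_{\{f_1,\dots,f_n\}}\ \frac1n\sum_{i=1}^n \|\vec\nabla f_i\|_{1,\phi}$$ (minimum over all positive orthonormal families of $n$ functions).
   Context: $G=(V,E)$ is a finite directed graph ($E\subseteq V\times V$, loops allowed). A kernel on $G$ is a matrix $K:V\times V\to[0,1]$ with $\sum_{v}K(u,v)=1$ for all $u$, such that $K(u,v)>0$ for every edge $uv\in E$ and $K(u,v)=0$ whenever $u\neq v$ and $uv\notin E$. A nowhere-zero stationary distribution is $\pi:V\to(0,\infty)$ with $\sum_u\pi(u)=1$ and $\sum_u\pi(u)K(u,v)=\pi(v)$ for all $v$. Put $\phi(u,v)=K(u,v)\pi(u)$. For $Q\subseteq V$: $\pi(Q)=\sum_{u\in Q}\pi(u)$ and $\vec\partial(Q)=\sum_{u\in Q,\,v\notin Q}\phi(u,v)$. For $f:V\to\mathbb R$: $\|f\|_{1,\pi}=\sum_u|f(u)|\pi(u)$, $\langle f,g\rangle_\pi=\sum_u f(u)g(u)\pi(u)$, and $\|\vec\nabla f\|_{1,\phi}=\sum_{u,v\in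 V}(f(u)-f(v))^+\phi(u,v)$ where $x^+=\max(x,0)$. A family $\{f_1,\dots,f_n\}$ is positive orthonormal if each $f_i:V\to[0,\infty)$ is not identically zero, $\|f_i\|_{1,\pi}=1$, and $\langle f_i,f_j\rangle_\pi=0$ for $i\ne j$. *)

theory Defs
  imports Complex_Main "HOL-Library.Disjoint_Sets" "Graph_Theory.Pair_Digraph"
begin

text \<open>
  Finite directed graphs, loops allowed, with edge set a subset of the square of the vertex set,
  are exactly the models of \<^locale>\<open>pair_fin_digraph\<close>. Functions on the vertices
  (or pairs of vertices) are total functions on the ambient type, of which only the values on the
  vertices are ever used.
\<close>

definition is_kernel :: "'a pair_pre_digraph \<Rightarrow> ('a \<Rightarrow> 'a \<Rightarrow> real) \<Rightarrow> bool" where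
  "is_kernel G K \<longleftrightarrow>
     (\<forall>u\<in>pverts G. \<forall>v\<in>pverts G. K u v \<in> {0..1}) \<and>
     (\<forall>u\<in>pverts G. (\<Sum>v\<in>pverts G. K u v) = 1) \<and>
     (\<forall>u v. (u, v) \<in> parcs G \<longrightarrow> K u v > 0) \<and>
     (\<forall>u\<in>pverts G. \<forall>v\<in>pverts G. u \<noteq> v \<and> (u, v) \<notin> parcs G \<longrightarrow> K u v = 0)"

definition nowhere_zero_stationary ::
    "'a pair_pre_digraph \<Rightarrow> ('a \<Rightarrow> 'a \<Rightarrow> real) \<Rightarrow> ('a \<Rightarrow> real) \<Rightarrow> bool" where
  "nowhere_zero_stationary G K \<pi> \<longleftrightarrow>
     (\<forall>u\<in>pverts G. \<pi> u > 0) \<and>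
     (\<Sum>u\<in>pverts G. \<pi> u) = 1 \<and>
     (\<forall>v\<in>pverts G. (\<Sum>u\<in>pverts G. \<pi> u * K u v) = \<pi> v)"

definition flow :: "('a \<Rightarrow> 'a \<Rightarrow> real) \<Rightarrow> ('a \<Rightarrow> real) \<Rightarrow> 'a \<Rightarrow> 'a \<Rightarrow> real" where
  "flow K \<pi> u v = K u v * \<pi> u"

definition set_weight :: "('a \<Rightarrow> real) \<Rightarrow> 'a set \<Rightarrow> real" where
  "set_weight \<pi> Q = (\<Sum>u\<in>Q. \<pi> u)"

definition out_boundary ::
    "'a pair_pre_digraph \<Rightarrow> ('a \<Rightarrow> 'a \<Rightarrow> real) \<Rightarrow> 'a set \<Rightarrow> real" where
  "out_boundary G \<phi> Q = (\<Sum>u\<in>Q. \<Sum>v\<in>pverts G - Q. \<phi> u v)"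

definition norm1 :: "'a pair_pre_digraph \<Rightarrow> ('a \<Rightarrow> real) \<Rightarrow> ('a \<Rightarrow> real) \<Rightarrow> real" where
  "norm1 G \<pi> f = (\<Sum>u\<in>pverts G. \<bar>f u\<bar> * \<pi> u)"

definition inner_pi ::
    "'a pair_pre_digraph \<Rightarrow> ('a \<Rightarrow> real) \<Rightarrow> ('a \<Rightarrow> real) \<Rightarrow> ('a \<Rightarrow> real) \<Rightarrow> real" where
  "inner_pi G \<pi> f g = (\<Sum>u\<in>pverts G. f u * g u * \<pi> u)"

definition grad_norm1 ::
    "'a pair_pre_digraph \<Rightarrow> ('a \<Rightarrow> 'a \<Rightarrow> real) \<Rightarrow> ('a \<Rightarrow> real) \<Rightarrow> real" where
  "grad_norm1 G \<phi> f = (\<Sum>u\<in>pverts G. \<Sum>v\<in>pverts G. max (f u - f v) 0 * \<phi> u v)"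

definition disjoint_nonempty_family ::
    "'a pair_pre_digraph \<Rightarrow> nat \<Rightarrow> (nat \<Rightarrow> 'a set) \<Rightarrow> bool" where
  "disjoint_nonempty_family G n Q \<longleftrightarrow>
     (\<forall>i\<in>{1..n}. Q i \<subseteq> pverts G \<and> Q i \<noteq> {}) \<and> disjoint_family_on Q {1..n}"

definition positive_orthonormal ::
    "'a pair_pre_digraph \<Rightarrow> ('a \<Rightarrow> real) \<Rightarrow> nat \<Rightarrow> (nat \<Rightarrow> 'a \<Rightarrow> real) \<Rightarrow> bool" where
  "positive_orthonormal G \<pi> n f \<longleftrightarrow>
     (\<forall>i\<in>{1..n}. (\<forall>u\<in>pverts G. f i u \<ge> 0) \<and> (\<exists>u\<in>pverts G. f i u \<noteq> 0) \<and>
        norm1 G \<pi> (f i) = 1) \<and>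
     (\<forall>i\<in>{1..n}. \<forall>j\<in>{1..n}. i \<noteq> j \<longrightarrow> inner_pi G \<pi> (f i) (f j) = 0)"

definition iota_values ::
    "'a pair_pre_digraph \<Rightarrow> ('a \<Rightarrow> 'a \<Rightarrow> real) \<Rightarrow> ('a \<Rightarrow> real) \<Rightarrow> nat \<Rightarrow> real set" where
  "iota_values G K \<pi> n =
     {1 / real n * (\<Sum>i=1..n. out_boundary G (flow K \<pi>) (Q i) / set_weight \<pi> (Q i)) | Q.
        disjoint_nonempty_family G n Q}"

definition gamma_values ::
    "'a pair_pre_digraph \<Rightarrow> ('a \<Rightarrow> 'a \<Rightarrow> real) \<Rightarrow> ('a \<Rightarrow> real) \<Rightarrow> nat \<Rightarrow> real set" where
  "gamma_values G K \<pi> n =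
     {1 / real n * (\<Sum>i=1..n. grad_norm1 G (flow K \<pi>) (f i)) | f.
        positive_orthonormal G \<pi> n f}"

definition is_minimum :: "real set \<Rightarrow> real \<Rightarrow> bool" where
  "is_minimum S m \<longleftrightarrow> m \<in> S \<and> (\<forall>x\<in>S. m \<le> x)"

text \<open>
  On the reals, LEAST denotes the minimum only if there is one; use these two constants
  together with \<^const>\<open>is_minimum\<close>. Stationary distributions need not be unique, hence the
  explicit argument \<open>\<pi>\<close>.
\<close>

definition iota ::
    "'a pair_pre_digraph \<Rightarrow> ('a \<Rightarrow> 'a \<Rightarrow> real) \<Rightarrow> ('a \<Rightarrow> real) \<Rightarrow> nat \<Rightarrow> real" where
  "iota G K \<pi> n = (LEAST x. x \<in> iota_values G K \<pi> n)"

definition gamma ::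
    "'a pair_pre_digraph \<Rightarrow> ('a \<Rightarrow> 'a \<Rightarrow> real) \<Rightarrow> ('a \<Rightarrow> real) \<Rightarrow> nat \<Rightarrow> real" where
  "gamma G K \<pi> n = (LEAST x. x \<in> gamma_values G K \<pi> n)"

end

(* A nonnegative function is a positive combination of the indicators of its superlevel sets, and
   both the 1-norm and the directed gradient norm are additive along this decomposition (co-area
   formula). Hence some superlevel set Q of f has boundary ratio at most the Rayleigh quotient of f.
   Positive orthonormal functions have disjoint supports, so these sets form an admissible family,
   and conversely normalised indicators turn a family of sets into a family of functions with the
   same value. There are only finitely many families of sets, so both minima exist. *)

theory Submission
  imports Defs "HOL-Library.Indicator_Function"
begin

text \<open>One step of the co-area formula: a bottom layer of height \<open>m\<close> on the
  support \<open>S\<close> is peeled off. Truncation subtracts \<open>m\<close> everywhere on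
  \<open>S\<close> and keeps the zeros outside, so differences inside \<open>S\<close> survive, a
  pair leaving \<open>S\<close> loses exactly \<open>m\<close>, and a pair starting outside
  \<open>S\<close> contributes zero before and after.\<close>

lemma grad_norm1_peel:
  fixes G :: "'a pair_pre_digraph" and f :: "'a \<Rightarrow> real" and m :: real
  defines "S \<equiv> {u \<in> pverts G. f u > 0}"
  assumes fin: "finite (pverts G)"
    and f: "\<And>u. u \<in> pverts G \<Longrightarrow> f u \<ge> 0"
    and m: "m \<ge> 0" "\<And>u. u \<in> S \<Longrightarrow> m \<le> f u"
  shows "grad_norm1 G \<phi> f = m * out_boundary G \<phi> S + grad_norm1 G \<phi> (\<lambda>u. max (f u - m) 0)"
proof -
  let ?V = "pverts G" and ?g = "\<lambda>u. max (f u - m) 0"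
  have S: "S \<subseteq> ?V" by (auto simp: S_def)
  have pt: "max (f u - f v) 0 * \<phi> u v =
      m * (if u \<in> S then if v \<in> ?V - S then \<phi> u v else 0 else 0) + max (?g u - ?g v) 0 * \<phi> u v"
    if uv: "u \<in> ?V" "v \<in> ?V" for u v
  proof (cases "u \<in> S")
    case True
    show ?thesis
    proof (cases "v \<in> S")
      case False
      then have "f v = 0" using uv f[of v] by (auto simp: S_def)
      then show ?thesis using True False uv m f[of u] by (auto simp: algebra_simps)
    qed (use True m(2)[of u] m(2)[of v] in auto)
  next
    case False
    then have "f u = 0" using uv f[of u] by (auto simp: S_def)
    then show ?thesis using False uv f[of v] m by (auto simp: max_def)
  qed
  \<comment> \<open>The boundary is padded with zeros to a sum over all pairs of vertices, so that
    \<open>pt\<close> can be summed term by term.\<close>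
  have "out_boundary G \<phi> S =
      (\<Sum>u\<in>?V. \<Sum>v\<in>?V. if u \<in> S then if v \<in> ?V - S then \<phi> u v else 0 else 0)"
  proof -
    have "out_boundary G \<phi> S = (\<Sum>u\<in>?V. if u \<in> S then \<Sum>v\<in>?V - S. \<phi> u v else 0)"
      unfolding out_boundary_def using S fin
      by (intro sum.mono_neutral_cong_left) auto
    moreover have "(\<Sum>v\<in>?V - S. \<phi> u v) = (\<Sum>v\<in>?V. if v \<in> ?V - S then \<phi> u v else 0)" for u
      using fin by (intro sum.mono_neutral_cong_left) auto
    ultimately show ?thesis by (auto intro!: sum.cong)
  qed
  then show ?thesis
    unfolding grad_norm1_def
    by (simp add: pt sum.distrib sum_distrib_left cong: sum.cong)
qed

text \<open>The companion of \<open>grad_norm1_peel\<close> for the same layer; together they allow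
  the two norms to be compared layer by layer.\<close>

lemma norm1_peel:
  fixes G :: "'a pair_pre_digraph" and f :: "'a \<Rightarrow> real" and m :: real
  defines "S \<equiv> {u \<in> pverts G. f u > 0}"
  assumes fin: "finite (pverts G)"
    and f: "\<And>u. u \<in> pverts G \<Longrightarrow> f u \<ge> 0"
    and m: "m \<ge> 0" "\<And>u. u \<in> S \<Longrightarrow> m \<le> f u"
  shows "norm1 G \<pi> f = m * set_weight \<pi> S + norm1 G \<pi> (\<lambda>u. max (f u - m) 0)"
proof -
  let ?V = "pverts G"
  have pt: "\<bar>f u\<bar> * \<pi> u = m * (if u \<in> S then \<pi> u else 0) + \<bar>max (f u - m) 0\<bar> * \<pi> u"
    if "u \<in> ?V" for u
    using that f[of u] m by (cases "u \<in> S") (auto simp: S_def algebra_simps)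
  have "set_weight \<pi> S = (\<Sum>u\<in>?V. if u \<in> S then \<pi> u else 0)"
    unfolding set_weight_def using fin
    by (intro sum.mono_neutral_cong_left) (auto simp: S_def)
  then show ?thesis
    unfolding norm1_def by (simp add: pt sum.distrib sum_distrib_left cong: sum.cong)
qed

text \<open>An isoperimetric bound on sets lifts to functions: it holds on each layer, and the
  layers add up. Since the bound is assumed for all subsets of the support, it is inherited by the
  truncations of \<open>f\<close>, whose supports shrink; this drives the induction on the support
  size.\<close>

lemma grad_norm1_lower_bound:
  fixes f :: "'a \<Rightarrow> real"
  assumes "finite (pverts G)"
    and "\<And>u. u \<in> pverts G \<Longrightarrow> f u \<ge> 0"
    and "\<And>Q. Q \<subseteq> {u \<in> pverts G. f u > 0} \<Longrightarrow> Q \<noteq> {} \<Longrightarrow> c * set_weight \<pi> Q \<le> out_boundary G \<phi> Q"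
  shows "c * norm1 G \<pi> f \<le> grad_norm1 G \<phi> f"
  using assms
proof (induction "card {u \<in> pverts G. f u > 0}" arbitrary: f rule: less_induct)
  case less
  let ?V = "pverts G"
  define S where "S = {u \<in> ?V. f u > 0}"
  have finS: "finite S" using less.prems(1) by (simp add: S_def)
  show ?case
  proof (cases "S = {}")
    case True
    then have "f u = 0" if "u \<in> ?V" for u
      using less.prems(2)[of u] that by (force simp: S_def)
    then show ?thesis by (simp add: norm1_def grad_norm1_def)
  next
    case False
    \<comment> \<open>Peeling at the least positive value removes its minimiser \<open>w\<close>
      from the support, so the support shrinks strictly.\<close>
    define m where "m = Min (f ` S)"
    define g where "g = (\<lambda>u. max (f u - m) 0)"
    have "m \<in> f ` S" unfolding m_def using finS False by simp
    then obtain w where w: "w \<in> S" "f w = m" by auto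
    have m: "m \<ge> 0" "\<And>u. u \<in> S \<Longrightarrow> m \<le> f u"
      using w finS by (auto simp: S_def m_def)
    let ?T = "{u \<in> ?V. g u > 0}"
    have T: "?T \<subseteq> S" using m by (auto simp: S_def g_def)
    moreover have "w \<notin> ?T" using w by (simp add: g_def)
    ultimately have "?T \<subset> S" using w by blast
    then have "card ?T < card S" using finS by (rule psubset_card_mono[rotated])
    then have IH: "c * norm1 G \<pi> g \<le> grad_norm1 G \<phi> g"
      using less.prems T by (intro less.hyps) (auto simp: S_def g_def)
    have "m * (c * set_weight \<pi> S) \<le> m * out_boundary G \<phi> S"
      using less.prems(3)[of S] m(1) False by (intro mult_left_mono) (auto simp: S_def)
    moreover have "grad_norm1 G \<phi> f = m * out_boundary G \<phi> S + grad_norm1 G \<phi> g"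
      unfolding S_def g_def using less.prems m by (intro grad_norm1_peel) (auto simp: S_def)
    moreover have "norm1 G \<pi> f = m * set_weight \<pi> S + norm1 G \<pi> g"
      unfolding S_def g_def using less.prems m by (intro norm1_peel) (auto simp: S_def)
    ultimately show ?thesis using IH by (simp add: algebra_simps)
  qed
qed

lemma set_weight_pos:
  assumes "finite (pverts G)" "\<And>u. u \<in> pverts G \<Longrightarrow> \<pi> u > 0" "Q \<subseteq> pverts G" "Q \<noteq> {}"
  shows "set_weight \<pi> Q > 0"
  unfolding set_weight_def using assms finite_subset by (intro sum_pos) auto

text \<open>The witness is a minimiser of the boundary ratio over all nonempty subsets of the
  support, not necessarily a superlevel set. Its ratio is then an admissible constant
  \<open>c\<close> in \<open>grad_norm1_lower_bound\<close>.\<close>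

lemma exists_subset_of_support_ratio_le:
  fixes f :: "'a \<Rightarrow> real"
  assumes fin: "finite (pverts G)"
    and \<pi>: "\<And>u. u \<in> pverts G \<Longrightarrow> \<pi> u > 0"
    and f: "\<And>u. u \<in> pverts G \<Longrightarrow> f u \<ge> 0" "\<exists>u\<in>pverts G. f u \<noteq> 0"
    and norm: "norm1 G \<pi> f = 1"
  shows "\<exists>Q. Q \<subseteq> {u \<in> pverts G. f u > 0} \<and> Q \<noteq> {} \<and>
    out_boundary G \<phi> Q / set_weight \<pi> Q \<le> grad_norm1 G \<phi> f"
proof -
  define A where "A = {Q. Q \<subseteq> {u \<in> pverts G. f u > 0} \<and> Q \<noteq> {}}"
  let ?r = "\<lambda>Q. out_boundary G \<phi> Q / set_weight \<pi> Q"
  have "finite A" unfolding A_def using fin by simp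
  moreover have "A \<noteq> {}"
  proof -
    obtain u where "u \<in> pverts G" "f u \<noteq> 0" using f(2) by blast
    then have "{u} \<in> A" using f(1)[of u] by (auto simp: A_def)
    then show ?thesis by blast
  qed
  ultimately have "Min (?r ` A) \<in> ?r ` A" and min: "\<And>Q. Q \<in> A \<Longrightarrow> Min (?r ` A) \<le> ?r Q" by auto
  then obtain Q where Q: "Q \<in> A" "?r Q = Min (?r ` A)" by fastforce
  have "?r Q * norm1 G \<pi> f \<le> grad_norm1 G \<phi> f"
  proof (rule grad_norm1_lower_bound[OF fin f(1)])
    fix P assume P: "P \<subseteq> {u \<in> pverts G. f u > 0}" "P \<noteq> {}"
    then have "?r Q \<le> ?r P" using min Q by (simp add: A_def)
    moreover have "set_weight \<pi> P > 0" using P by (intro set_weight_pos[OF fin \<pi>]) auto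
    ultimately show "?r Q * set_weight \<pi> P \<le> out_boundary G \<phi> P" by (simp add: pos_le_divide_eq)
  qed
  then have "?r Q \<le> grad_norm1 G \<phi> f" using norm by simp
  moreover have "Q \<subseteq> {u \<in> pverts G. f u > 0}" "Q \<noteq> {}" using Q(1) by (simp_all add: A_def)
  ultimately show ?thesis by blast
qed

lemma norm1_normalised_indicator:
  assumes fin: "finite (pverts G)" and Q: "Q \<subseteq> pverts G" and w: "set_weight \<pi> Q > 0"
  shows "norm1 G \<pi> (\<lambda>u. indicator Q u / set_weight \<pi> Q) = 1"
proof -
  have "norm1 G \<pi> (\<lambda>u. indicator Q u / set_weight \<pi> Q) = (\<Sum>u\<in>Q. \<pi> u / set_weight \<pi> Q)"
    unfolding norm1_def using fin Q w
    by (intro sum.mono_neutral_cong_right) (auto simp: indicator_def)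
  also have "\<dots> = 1" using w by (simp add: sum_divide_distrib[symmetric] set_weight_def)
  finally show ?thesis .
qed

text \<open>The function has a single layer, of height \<open>1 / set_weight \<pi> Q\<close>;
  peeling it off leaves the zero function.\<close>

lemma grad_norm1_normalised_indicator:
  assumes fin: "finite (pverts G)" and Q: "Q \<subseteq> pverts G" and w: "set_weight \<pi> Q > 0"
  shows "grad_norm1 G \<phi> (\<lambda>u. indicator Q u / set_weight \<pi> Q) =
    out_boundary G \<phi> Q / set_weight \<pi> Q"
proof -
  let ?f = "\<lambda>u. indicator Q u / set_weight \<pi> Q"
  have S: "{u \<in> pverts G. ?f u > 0} = Q"
    using Q w by (auto simp: indicator_def of_bool_def split: if_splits)
  have "grad_norm1 G \<phi> ?f = 1 / set_weight \<pi> Q * out_boundary G \<phi> {u \<in> pverts G. ?f u > 0} +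
      grad_norm1 G \<phi> (\<lambda>u. max (?f u - 1 / set_weight \<pi> Q) 0)"
    using w by (intro grad_norm1_peel fin)
      (auto simp: indicator_def of_bool_def split: if_splits)
  moreover have "(\<lambda>u. max (?f u - 1 / set_weight \<pi> Q) 0) = (\<lambda>u. 0)"
    using w by (auto simp: indicator_def)
  ultimately show ?thesis unfolding S by (simp add: grad_norm1_def)
qed

text \<open>Normalised indicators of disjoint sets have pointwise product zero, hence are
  orthogonal, and they preserve the value.\<close>

lemma iota_values_subset_gamma_values:
  fixes G :: "'a pair_pre_digraph"
  assumes fin: "finite (pverts G)" and \<pi>: "\<And>u. u \<in> pverts G \<Longrightarrow> \<pi> u > 0"
  shows "iota_values G K \<pi> n \<subseteq> gamma_values G K \<pi> n"
proof
  fix x assume "x \<in> iota_values G K \<pi> n"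
  then obtain Q where x: "x = 1 / real n *
      (\<Sum>i=1..n. out_boundary G (flow K \<pi>) (Q i) / set_weight \<pi> (Q i))"
    and Q: "disjoint_nonempty_family G n Q" by (auto simp: iota_values_def)
  define f :: "nat \<Rightarrow> 'a \<Rightarrow> real"
    where "f i u = indicator (Q i) u / set_weight \<pi> (Q i)" for i u
  have sub: "Q i \<subseteq> pverts G" "Q i \<noteq> {}" if "i \<in> {1..n}" for i
    using Q that by (auto simp: disjoint_nonempty_family_def)
  have w: "set_weight \<pi> (Q i) > 0" if "i \<in> {1..n}" for i
    using sub[OF that] by (intro set_weight_pos[OF fin \<pi>])
  have "positive_orthonormal G \<pi> n f"
    unfolding positive_orthonormal_def
  proof (intro conjI ballI impI)
    fix i assume i: "i \<in> {1..n}"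
    show "norm1 G \<pi> (f i) = 1"
      unfolding f_def using norm1_normalised_indicator[OF fin sub(1)[OF i] w[OF i]] .
    show "f i u \<ge> 0" for u using w[OF i] by (simp add: f_def)
    show "\<exists>u\<in>pverts G. f i u \<noteq> 0"
      using sub[OF i] w[OF i] by (auto simp: f_def indicator_def)
    fix j assume j: "j \<in> {1..n}" "i \<noteq> j"
    have "Q i \<inter> Q j = {}"
      using Q i j by (auto simp: disjoint_nonempty_family_def disjoint_family_on_def)
    then show "inner_pi G \<pi> (f i) (f j) = 0"
      by (auto simp: inner_pi_def f_def indicator_def intro!: sum.neutral)
  qed
  moreover have "x = 1 / real n * (\<Sum>i=1..n. grad_norm1 G (flow K \<pi>) (f i))"
    unfolding x f_def using grad_norm1_normalised_indicator[OF fin sub(1) w] by simp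
  ultimately show "x \<in> gamma_values G K \<pi> n" by (auto simp: gamma_values_def)
qed

text \<open>Each function is replaced by a set inside its support with no larger ratio;
  orthogonality makes the supports, and so these sets, disjoint.\<close>

lemma gamma_value_ge_iota_value:
  assumes fin: "finite (pverts G)" and \<pi>: "\<And>u. u \<in> pverts G \<Longrightarrow> \<pi> u > 0"
    and y: "y \<in> gamma_values G K \<pi> n"
  shows "\<exists>x\<in>iota_values G K \<pi> n. x \<le> y"
proof -
  let ?V = "pverts G" and ?\<phi> = "flow K \<pi>"
  obtain f where y: "y = 1 / real n * (\<Sum>i=1..n. grad_norm1 G ?\<phi> (f i))"
    and f: "positive_orthonormal G \<pi> n f" using y by (auto simp: gamma_values_def)
  have "\<forall>i\<in>{1..n}. \<exists>Q. Q \<subseteq> {u \<in> ?V. f i u > 0} \<and> Q \<noteq> {} \<and>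
      out_boundary G ?\<phi> Q / set_weight \<pi> Q \<le> grad_norm1 G ?\<phi> (f i)"
    using f by (intro ballI exists_subset_of_support_ratio_le fin \<pi>)
      (auto simp: positive_orthonormal_def)
  then obtain Q where Q: "\<And>i. i \<in> {1..n} \<Longrightarrow> Q i \<subseteq> {u \<in> ?V. f i u > 0} \<and> Q i \<noteq> {} \<and>
      out_boundary G ?\<phi> (Q i) / set_weight \<pi> (Q i) \<le> grad_norm1 G ?\<phi> (f i)"
    by metis
  have "Q i \<inter> Q j = {}" if ij: "i \<in> {1..n}" "j \<in> {1..n}" "i \<noteq> j" for i j
  proof (rule ccontr)
    assume "Q i \<inter> Q j \<noteq> {}"
    then obtain u where u: "u \<in> ?V" "f i u > 0" "f j u > 0" using Q ij by blast
    \<comment> \<open>A vanishing sum of nonnegative terms has only zero terms, but the term at the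
      common vertex \<open>u\<close> is positive.\<close>
    have "(\<Sum>u\<in>?V. f i u * f j u * \<pi> u) = 0"
      using f ij by (simp add: positive_orthonormal_def inner_pi_def)
    moreover have "0 \<le> f i v * f j v * \<pi> v" if "v \<in> ?V" for v
      using f ij that \<pi>[OF that] by (simp add: positive_orthonormal_def)
    ultimately have "f i u * f j u * \<pi> u = 0"
      using u(1) fin by (simp add: sum_nonneg_eq_0_iff)
    then show False using u \<pi>[of u] by simp
  qed
  then have "disjoint_nonempty_family G n Q"
    using Q unfolding disjoint_nonempty_family_def disjoint_family_on_def by blast
  then have "1 / real n * (\<Sum>i=1..n. out_boundary G ?\<phi> (Q i) / set_weight \<pi> (Q i))
      \<in> iota_values G K \<pi> n" by (auto simp: iota_values_def)
  moreover have "1 / real n * (\<Sum>i=1..n. out_boundary G ?\<phi> (Q i) / set_weight \<pi> (Q i)) \<le> y"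
    unfolding y using Q by (intro mult_left_mono sum_mono) auto
  ultimately show ?thesis by blast
qed

text \<open>A family \<open>Q\<close> is a function on all of \<open>nat\<close>, but its value
  depends only on the indices in \<open>{1..n}\<close>; restricting to them leaves finitely many
  families.\<close>

lemma finite_iota_values:
  assumes fin: "finite (pverts G)"
  shows "finite (iota_values G K \<pi> n)"
proof (rule finite_subset)
  let ?h = "\<lambda>Q. 1 / real n * (\<Sum>i=1..n. out_boundary G (flow K \<pi>) (Q i) / set_weight \<pi> (Q i))"
  show "iota_values G K \<pi> n \<subseteq> ?h ` PiE {1..n} (\<lambda>_. Pow (pverts G))"
  proof
    fix x assume "x \<in> iota_values G K \<pi> n"
    then obtain Q where "x = ?h Q" "disjoint_nonempty_family G n Q"
      by (auto simp: iota_values_def)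
    then have "x = ?h (restrict Q {1..n})" "restrict Q {1..n} \<in> PiE {1..n} (\<lambda>_. Pow (pverts G))"
      by (auto simp: disjoint_nonempty_family_def)
    then show "x \<in> ?h ` PiE {1..n} (\<lambda>_. Pow (pverts G))" by blast
  qed
  show "finite (?h ` PiE {1..n} (\<lambda>_. Pow (pverts G)))"
    using fin by (intro finite_imageI finite_PiE) auto
qed

text \<open>Since \<open>n\<close> is at most the number of vertices, \<open>n\<close> distinct
  singletons form an admissible family.\<close>

lemma iota_values_nonempty:
  assumes fin: "finite (pverts G)" and n: "n \<le> card (pverts G)"
  shows "iota_values G K \<pi> n \<noteq> {}"
proof -
  have "card {1..n} \<le> card (pverts G)" using n by simp
  then obtain h where h: "h ` {1..n} \<subseteq> pverts G" "inj_on h {1..n}"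
    using card_le_inj[OF finite_atLeastAtMost fin] by blast
  then have "disjoint_nonempty_family G n (\<lambda>i. {h i})"
    unfolding disjoint_nonempty_family_def disjoint_family_on_def
    by (simp add: image_subset_iff inj_on_eq_iff)
  then show ?thesis unfolding iota_values_def by blast
qed

lemma Least_eq_of_is_minimum:
  assumes "is_minimum S m"
  shows "(LEAST x. x \<in> S) = m"
  using assms by (intro Least_equality) (auto simp: is_minimum_def)

theorem theorem1:
  fixes G :: "'a pair_pre_digraph"
    and K :: "'a \<Rightarrow> 'a \<Rightarrow> real"
    and \<pi> :: "'a \<Rightarrow> real"
    and n :: nat
  assumes "pair_fin_digraph G"
    and "is_kernel G K"
    and "nowhere_zero_stationary G K \<pi>"
    and "1 \<le> n" and "n \<le> card (pverts G)"
  shows "is_minimum (iota_values G K \<pi> n) (iota G K \<pi> n) \<and>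
    is_minimum (gamma_values G K \<pi> n) (gamma G K \<pi> n) \<and>
    iota G K \<pi> n = gamma G K \<pi> n"
proof -
  let ?I = "iota_values G K \<pi> n" and ?\<Gamma> = "gamma_values G K \<pi> n"
  have fin: "finite (pverts G)" using assms(1) by (rule pair_fin_digraph.pair_finite_verts)
  have \<pi>: "\<And>u. u \<in> pverts G \<Longrightarrow> \<pi> u > 0"
    using assms(3) by (simp add: nowhere_zero_stationary_def)
  \<comment> \<open>This one number is shown to be the minimum of both sets. For the possibly
    infinite set \<open>?\<Gamma>\<close> this also settles that the minimum is attained, without a
    compactness argument.\<close>
  define m where "m = Min ?I"
  have I: "is_minimum ?I m"
    unfolding is_minimum_def m_def
    using finite_iota_values[OF fin] iota_values_nonempty[OF fin assms(5)] by simp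
  moreover have "is_minimum ?\<Gamma> m"
    unfolding is_minimum_def
  proof (intro conjI ballI)
    show "m \<in> ?\<Gamma>"
      using I iota_values_subset_gamma_values[where \<pi> = \<pi>, OF fin \<pi>] by (auto simp: is_minimum_def)
    fix y assume "y \<in> ?\<Gamma>"
    then obtain x where "x \<in> ?I" "x \<le> y" using gamma_value_ge_iota_value[where \<pi> = \<pi>, OF fin \<pi>] by blast
    then show "m \<le> y" using I by (force simp: is_minimum_def)
  qed
  ultimately show ?thesis
    by (simp add: iota_def gamma_def Least_eq_of_is_minimum)
qed

end
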